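(* Let $k,m\in\mathbb{N}_0$ with $m\le k$. For $x\in(-1,1)$ there are two pairs of mutually inverse relations: $$\frac{P_k^{-m}(x)}{2^mk!\,x^{k+m}}=\sum_{n=0}^{k}\frac{(-1)^ng_n(k+m,-2m)}{(k-n)!}\,\frac{(1-x)^{\frac n2}P_{k+m}^{-n-m}\left(\frac1x\right)}{(1+x)^{\frac n2+m}},$$ $$\frac{P_k^{-m}\left(\frac1x\right)}{2^mk!\,x^{-k}}=\sum_{n=0}^{k}\frac{g_n(k+m,-2m)}{(k-n)!}\,\frac{(1-x)^{\frac n2}P_{k+m}^{-n-m}(x)}{(1+x)^{\frac n2+m}},$$ and $$\frac{P_k^{m}(x)}{2^{-m}k!\,x^{k-m}}=\sum_{n=\max(0,2m-k)}^{k}\frac{(-1)^ng_n(k-m,2m)}{(k-n)!}\,\frac{(1-x)^{\frac n2}P_{k-m}^{m-n}\left(\frac1x\right)}{(1+x)^{\frac n2-m}},$$ $$\frac{P_k^{m}\left(\frac1x\right)}{2^{-m}k!\,x^{-k}}=\sum_{n=\max(0,2m-k)}^{k}\frac{g_n(k-m,2m)}{(k-n)!}\,\frac{(1-x)^{\frac n2}P_{k-m}^{m-n}(x)}{(1+x)^{\frac n2-m}}.$$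
   Context: $\mathbb{N}_0=\{0,1,2,\dots\}$. The polynomials $g_n(\tau,r)$ are defined by $(1+u)^{\tau+r}(1-u)^{-\tau}=\sum_{n=0}^\infty g_n(\tau,r)u^n$, $|u|<1$. $P_k^{\pm m}$ ($k,m\in\mathbb{N}_0$) are the associated Legendre polynomials, given for $k\ge m$ by $$P_k^{m}(x)=(-1)^m\frac{(k+m)!}{(k-m)!}P_k^{-m}(x)=\frac{(-1)^m(2m)!}{2^m m!}\,|1-x^2|^{\frac m2}\,C_{k-m}^{m+1/2}(x),$$ and $P_k^m(x)=0$ for $k<m$. Here $C_k^{\tau}(x)=\frac{1}{\Gamma(\tau)}\sum_{j=0}^{[k/2]}\frac{(-1)^j\Gamma(k-j+\tau)}{j!\,(k-2j)!}(2x)^{k-2j}$ is the Gegenbauer polynomial and $[\cdot]$ is the integer part.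
   Formalization: For |x|>1 the given formula for P_k^{±m} makes the relations fail by signs (e.g. the fourth at k=m=1, 0<x<1); there it is multiplied by sgn(x)^m, and for positive order m also by (-1)^m, the standard function off the cut. The point x=0, where 1/x is undefined, is excluded. *)

theory Defs
  imports "HOL-Analysis.Analysis"
begin

definition g_coeff :: "nat \<Rightarrow> real \<Rightarrow> real \<Rightarrow> real" where
  "g_coeff n \<tau> r =
     (THE a. \<forall>u::real. \<bar>u\<bar> < 1 \<longrightarrow>
        (\<lambda>j. a j * u ^ j) sums ((1 + u) powr (\<tau> + r) * (1 - u) powr (- \<tau>))) n"

text \<open>The description is proper: the expansion exists and is unique.\<close>

lemma g_coeff_ex1:
  "\<exists>!a. \<forall>u::real. \<bar>u\<bar> < 1 \<longrightarrow>
     (\<lambda>j. a j * u ^ j) sums ((1 + u) powr (\<tau> + r) * (1 - u) powr (- \<tau>))"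
    (is "\<exists>!a. \<forall>u. _ \<longrightarrow> (\<lambda>j. a j * u ^ j) sums ?h u")
proof (rule ex_ex1I)
  define b where "b = (\<lambda>j. ((\<tau> + r) gchoose j))"
  define c where "c = (\<lambda>j. ((- \<tau>) gchoose j) * (-1) ^ j)"
  define a where "a = (\<lambda>n. \<Sum>i\<le>n. b i * c (n - i))"
  have "(\<lambda>j. a j * u ^ j) sums ?h u" if u: "\<bar>u\<bar> < 1" for u :: real
  proof -
    have sb: "(\<lambda>j. b j * v ^ j) sums (1 + v) powr (\<tau> + r)" if "\<bar>v\<bar> < 1" for v
      unfolding b_def using gen_binomial_real[OF that] .
    have sc: "(\<lambda>j. c j * v ^ j) sums (1 - v) powr (- \<tau>)" if "\<bar>v\<bar> < 1" for v
      using gen_binomial_real[of "- v" "- \<tau>"] that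
      by (simp add: c_def mult.assoc flip: power_mult_distrib)
    obtain v where v: "\<bar>u\<bar> < v" "v < 1" using u dense by blast
    then have "\<bar>v\<bar> < 1" by simp
    then have ab: "summable (\<lambda>j. norm (b j * u ^ j))" "summable (\<lambda>j. norm (c j * u ^ j))"
      using v powser_insidea[OF sums_summable[OF sb], of v u]
        powser_insidea[OF sums_summable[OF sc], of v u] by auto
    have "(\<lambda>k. \<Sum>i\<le>k. (b i * u ^ i) * (c (k - i) * u ^ (k - i))) sums
        ((\<Sum>k. b k * u ^ k) * (\<Sum>k. c k * u ^ k))"
      by (rule Cauchy_product_sums[OF ab])
    moreover have "(\<Sum>i\<le>k. (b i * u ^ i) * (c (k - i) * u ^ (k - i))) = a k * u ^ k" for k
      unfolding a_def sum_distrib_right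
      by (rule sum.cong) (auto simp: algebra_simps simp flip: power_add)
    ultimately show ?thesis
      using sums_unique[OF sb[OF u]] sums_unique[OF sc[OF u]] by simp
  qed
  then show "\<exists>a. \<forall>u. \<bar>u\<bar> < 1 \<longrightarrow> (\<lambda>j. a j * u ^ j) sums ?h u" by blast
next
  fix a a' :: "nat \<Rightarrow> real"
  assume A: "\<forall>u. \<bar>u\<bar> < 1 \<longrightarrow> (\<lambda>j. a j * u ^ j) sums ?h u"
    and A': "\<forall>u. \<bar>u\<bar> < 1 \<longrightarrow> (\<lambda>j. a' j * u ^ j) sums ?h u"
  have D: "(\<lambda>j. (a j - a' j) * u ^ j) sums 0" if "\<bar>u\<bar> < 1" for u
    using sums_diff[OF A[rule_format, OF that] A'[rule_format, OF that]]
    by (simp add: algebra_simps)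
  have "a n - a' n = 0" for n
  proof (rule ccontr)
    assume n: "a n - a' n \<noteq> 0"
    define N where "N = (LEAST n. a n - a' n \<noteq> 0)"
    have N: "a N - a' N \<noteq> 0" unfolding N_def by (rule LeastI) (rule n)
    have lt: "a j - a' j = 0" if "j < N" for j using not_less_Least that N_def by blast
    define d where "d = (\<lambda>j. a (j + N) - a' (j + N))"
    have S: "(\<lambda>j. d j * u ^ j) sums 0" if "\<bar>u\<bar> < 1" "u \<noteq> 0" for u
    proof -
      have "(\<Sum>i<N. (a i - a' i) * u ^ i) = 0" using lt by (intro sum.neutral) simp
      then have "(\<lambda>j. (a (j + N) - a' (j + N)) * u ^ (j + N)) sums 0"
        using sums_split_initial_segment[OF D[OF that(1)], of N] by simp
      from sums_mult[OF this, of "inverse (u ^ N)"]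
      have "(\<lambda>j. inverse (u ^ N) * (d j * u ^ (j + N))) sums 0" by (simp add: d_def)
      moreover have "inverse (u ^ N) * (d j * u ^ (j + N)) = d j * u ^ j" for j
        using that by (simp add: power_add)
      ultimately show ?thesis by (simp only:)
    qed
    have "((\<lambda>u. 0) \<longlongrightarrow> d 0) (at (0::real))"
      by (rule powser_limit_0_strong[of 1 d]) (use S in auto)
    then have "d 0 = 0" using tendsto_unique[of "at (0::real)"] tendsto_const by (metis at_neq_bot)
    then show False using N by (simp add: d_def)
  qed
  then show "a = a'" by (intro ext) simp
qed

lemma g_coeff_sums:
  assumes "\<bar>u::real\<bar> < 1"
  shows "(\<lambda>n. g_coeff n \<tau> r * u ^ n) sums ((1 + u) powr (\<tau> + r) * (1 - u) powr (- \<tau>))"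
  using theI'[OF g_coeff_ex1[of \<tau> r]] assms unfolding g_coeff_def by blast

definition gegenbauer :: "nat \<Rightarrow> real \<Rightarrow> real \<Rightarrow> real" where
  "gegenbauer k \<tau> x =
     1 / Gamma \<tau> * (\<Sum>j = 0..k div 2.
       (-1) ^ j * Gamma (real k - real j + \<tau>) / (fact j * fact (k - 2 * j)) * (2 * x) ^ (k - 2 * j))"

text \<open>
  The order is an integer, so that both signs of the superscript \<open>\<plusminus>m\<close> are covered; the value is \<open>0\<close>
  for \<open>k < m\<close>. The \<open>m\<close>-th power of a square root stands for the exponent \<open>m/2\<close>; it is also
  correct for \<open>m = 0\<close> at \<open>x = \<plusminus>1\<close>, where \<open>0 powr 0 = 0\<close> would not be.
\<close>

definition assoc_legendre_abs :: "nat \<Rightarrow> int \<Rightarrow> real \<Rightarrow> real" where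
  "assoc_legendre_abs k \<mu> x =
     (let m = nat \<bar>\<mu>\<bar>;
          P = (-1) ^ m * fact (2 * m) / (2 ^ m * fact m) * sqrt \<bar>1 - x\<^sup>2\<bar> ^ m
                * gegenbauer (k - m) (real m + 1 / 2) x
      in if k < m then 0
         else if 0 \<le> \<mu> then P
         else (-1) ^ m * fact (k - m) / fact (k + m) * P)"

text \<open>
  The formula above, with the sign \<open>(-1)\<^sup>m\<close> and the absolute value, is the function on the cut
  \<open>[-1, 1]\<close>. Off the cut the associated Legendre functions are restrictions of functions analytic
  there: \<open>(z - 1) powr (m/2) * (z + 1) powr (m/2)\<close>, with principal roots, times the \<open>m\<close>-th derivative
  of the Legendre polynomial for order \<open>m\<close>, and \<open>(k - m)! / (k + m)!\<close> times this for order \<open>-m\<close>.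
  So there the sign \<open>(-1)\<^sup>m\<close> is absent, while the product of the roots is \<open>(sgn z * sqrt (z\<^sup>2 - 1)) ^ m\<close>
  for real \<open>z\<close>. Identities relating values at \<open>x\<close> to values at \<open>1/x\<close> need this convention: with
  \<open>assoc_legendre_abs\<close> on the whole real line they fail by signs.
\<close>

definition assoc_legendre :: "nat \<Rightarrow> int \<Rightarrow> real \<Rightarrow> real" where
  "assoc_legendre k \<mu> x =
     (if \<bar>x\<bar> \<le> 1 then 1
      else sgn x ^ nat \<bar>\<mu>\<bar> * (if 0 < \<mu> then (-1) ^ nat \<mu> else 1))
     * assoc_legendre_abs k \<mu> x"

lemma assoc_legendre_on_cut: "\<bar>x\<bar> \<le> 1 \<Longrightarrow> assoc_legendre k \<mu> x = assoc_legendre_abs k \<mu> x"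
  by (simp add: assoc_legendre_def)

lemma assoc_legendre_off_cut:
  assumes "1 < \<bar>x\<bar>" and "m \<le> k"
  shows "assoc_legendre k (int m) x =
      fact (2 * m) / (2 ^ m * fact m) * (sgn x * sqrt (x\<^sup>2 - 1)) ^ m
        * gegenbauer (k - m) (real m + 1 / 2) x"
    and "assoc_legendre k (- int m) x =
      fact (k - m) / fact (k + m) * assoc_legendre k (int m) x"
proof -
  have "1 < x\<^sup>2" using one_less_power[OF assms(1), of 2] by (simp only: power2_abs pos2)
  then have x: "\<bar>1 - x\<^sup>2\<bar> = x\<^sup>2 - 1" by linarith
  have sg: "(-1) ^ m * ((-1) ^ m * y) = y" for y :: real
    by (simp flip: mult.assoc power_mult_distrib)
  have off: "\<not> \<bar>x\<bar> \<le> 1" "\<not> k < m" using assms by auto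
  have "assoc_legendre k (int m) x = sgn x ^ m * ((-1) ^ m *
      ((-1) ^ m * (fact (2 * m) / (2 ^ m * fact m) * sqrt (x\<^sup>2 - 1) ^ m
        * gegenbauer (k - m) (real m + 1 / 2) x)))"
    using off by (cases "m = 0") (simp_all add: assoc_legendre_def assoc_legendre_abs_def x)
  then show "assoc_legendre k (int m) x =
      fact (2 * m) / (2 ^ m * fact m) * (sgn x * sqrt (x\<^sup>2 - 1)) ^ m
        * gegenbauer (k - m) (real m + 1 / 2) x"
    unfolding sg power_mult_distrib by (simp only: mult_ac)
  show "assoc_legendre k (- int m) x = fact (k - m) / fact (k + m) * assoc_legendre k (int m) x"
    using off by (cases "m = 0") (simp_all add: assoc_legendre_def assoc_legendre_abs_def mult_ac)
qed

end

theory Submission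
  imports Defs
begin

text \<open>
  Write \<open>K = k + s\<close>, \<open>A = k - s\<close> with \<open>s = m\<close> for the first pair of relations and \<open>s = - m\<close> for
  the second. Both pairs are then the same two identities, and only \<open>K + A = 2 k\<close> matters
  (\<open>assoc_legendre_expansions\<close>).

  By Rodrigues' formula an associated Legendre function of degree \<open>K\<close> and order \<open>N - K\<close> is an
  elementary factor times \<open>N!\<close> times the coefficient of \<open>t ^ N\<close> in \<open>((t + z)\<^sup>2 - 1) ^ K\<close>
  (\<open>assoc_legendre_eq_rodrigues_coeff\<close>). The functions on the right-hand sides have
  \<open>N = k - n\<close>, so \<open>N!\<close> cancels against \<open>(k - n)!\<close>, the remaining elementary factors combine to
  an \<open>n\<close>-th power, and the sum becomes a Cauchy product: the coefficient of \<open>t ^ k\<close> in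
  \<open>G (- t / (1 + z)) ((t + z)\<^sup>2 - 1) ^ K\<close>, where \<open>G u = (1 + u) ^ A / (1 - u) ^ K\<close> generates the
  \<open>g\<^sub>n\<close> and \<open>z\<close> is \<open>1 / x\<close> or \<open>x\<close>. The denominator of \<open>G\<close> cancels the factor
  \<open>(t + z + 1) ^ K\<close>, leaving \<open>(1 + z - t) ^ A (t + z - 1) ^ K\<close> up to a power of \<open>1 + z\<close>
  (\<open>sum_g_coeff_rodrigues_coeff\<close>).

  The coefficient of \<open>t ^ k\<close> in this product agrees term by term, up to a common factor, with the
  coefficient of \<open>t ^ A\<close> in \<open>((t + 1 / z)\<^sup>2 - 1) ^ k\<close>, because
  \<open>k!\<^sup>2 (A choose j) (K choose (k - j)) = A! K! (k choose j) (k choose (A - j))\<close>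
  (\<open>fps_coeff_eq_rodrigues_coeff_inverse\<close>). This is the Rodrigues coefficient of the function of
  degree \<open>k\<close> and order \<open>A - k = - s\<close> at \<open>1 / z\<close>, that is, the left-hand side.
\<close>

unbundle no vec_syntax
unbundle fps_syntax

section \<open>Rodrigues coefficients\<close>

text \<open>
  This is \<open>1 / N!\<close> times the \<open>N\<close>-th derivative of \<open>(x\<^sup>2 - 1) ^ K\<close>. As a coefficient it can be
  read off from different factorizations, without any differentiation.
\<close>

definition rodrigues_coeff :: "nat \<Rightarrow> nat \<Rightarrow> real \<Rightarrow> real" where
  "rodrigues_coeff K N x = (((fps_X + fps_const x)\<^sup>2 - 1) ^ K) $ N"

lemma fps_linear_power_nth:
  fixes a b :: real
  shows "((fps_const b * fps_X + fps_const a) ^ n) $ i = of_nat (n choose i) * b ^ i * a ^ (n - i)"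
proof -
  have "fps_const b * fps_X + fps_const a = fps_of_poly [:a, b:]"
    by (simp add: fps_of_poly_pCons mult.commute)
  then have "((fps_const b * fps_X + fps_const a) ^ n) $ i = coeff ([:a, b:] ^ n) i"
    by (simp only: fps_of_poly_power[symmetric] fps_of_poly_nth)
  moreover have "coeff ([:a, b:] ^ n) i = 0" if "n < i"
    using degree_power_le[of "[:a, b:]" n] that
    by (intro coeff_eq_0) (cases "b = 0", auto)
  ultimately show ?thesis
    using coeff_linear_poly_power[of i n a b] by (cases "i \<le> n") (auto simp: binomial_eq_0)
qed

lemma fps_linear_power_nth1:
  fixes a :: real
  shows "((fps_X + fps_const a) ^ n) $ i = of_nat (n choose i) * a ^ (n - i)"
  using fps_linear_power_nth[of 1 a n i] by simp

lemma fps_rodrigues_factor: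
  fixes x :: real
  shows "(fps_X + fps_const x)\<^sup>2 - 1 = (fps_X + fps_const (x + 1)) * (fps_X + fps_const (x - 1))"
  by (simp add: power2_eq_square algebra_simps flip: fps_const_sub fps_const_add)

text \<open>
  The expansion by the two linear factors of \<open>(t + x)\<^sup>2 - 1\<close> serves for reflection and for the passage
  from \<open>z\<close> to \<open>1 / z\<close>; the next one, by powers of \<open>(t + x)\<^sup>2\<close>, has the shape of the Gegenbauer sum.
\<close>

lemma rodrigues_coeff_product:
  "rodrigues_coeff K N x =
    (\<Sum>i\<le>N. real (K choose i) * real (K choose (N - i)) * (x + 1) ^ (K - i) * (x - 1) ^ (K - (N - i)))"
  unfolding rodrigues_coeff_def fps_rodrigues_factor power_mult_distrib fps_mult_nth
    fps_linear_power_nth1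
  by (auto intro!: sum.cong simp: atLeast0AtMost mult_ac)

lemma rodrigues_coeff_expand:
  "rodrigues_coeff K N x =
    (\<Sum>j\<le>K. real (K choose j) * (-1) ^ j * real ((2 * (K - j)) choose N) * x ^ (2 * (K - j) - N))"
proof -
  have "((fps_X + fps_const x)\<^sup>2 - 1) ^ K = (- 1 + (fps_X + fps_const x)\<^sup>2) ^ K"
    by simp
  also have "\<dots> = (\<Sum>j\<le>K. fps_const (real (K choose j) * (-1) ^ j) * (fps_X + fps_const x) ^ (2 * (K - j)))"
    by (subst binomial_ring, intro sum.cong)
      (simp_all only: fps_of_nat[symmetric] power_mult fps_const_mult[symmetric] fps_const_power[symmetric]
        fps_const_neg[symmetric] fps_const_1_eq_1)
  finally show ?thesis
    unfolding rodrigues_coeff_def by (simp add: fps_sum_nth fps_linear_power_nth1 mult_ac)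
qed

lemma rodrigues_coeff_eq_0: "2 * K < N \<Longrightarrow> rodrigues_coeff K N x = 0"
  unfolding rodrigues_coeff_expand by (intro sum.neutral) (auto simp: binomial_eq_0)

text \<open>
  The two derivatives of \<open>(x\<^sup>2 - 1) ^ K\<close> of orders \<open>K - m\<close> and \<open>K + m\<close> are proportional, which is what
  relates Legendre functions of opposite order. In the expansion by the factors \<open>t + x + 1\<close> and
  \<open>t + x - 1\<close>, the substitution \<open>i \<rightarrow> i - m\<close> matches the terms.
\<close>

lemma rodrigues_coeff_reflect:
  assumes "m \<le> K"
  shows "rodrigues_coeff K (K - m) x = (x\<^sup>2 - 1) ^ m * rodrigues_coeff K (K + m) x"
proof -
  have "rodrigues_coeff K (K + m) x =
      (\<Sum>i\<in>{m..K}. real (K choose i) * real (K choose (K + m - i)) * (x + 1) ^ (K - i) * (x - 1) ^ (K - (K + m - i)))"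
    unfolding rodrigues_coeff_product using assms
    by (intro sum.mono_neutral_right) (auto simp: binomial_eq_0)
  then have "(x\<^sup>2 - 1) ^ m * rodrigues_coeff K (K + m) x = (x\<^sup>2 - 1) ^ m *
      (\<Sum>i\<in>{m..K}. real (K choose i) * real (K choose (K + m - i)) * (x + 1) ^ (K - i) * (x - 1) ^ (K - (K + m - i)))"
    by (simp only:)
  also have "\<dots> =
      (\<Sum>i\<le>K - m. real (K choose i) * real (K choose (K - m - i)) * (x + 1) ^ (K - i) * (x - 1) ^ (K - (K - m - i)))"
    unfolding sum_distrib_left
  proof (rule sum.reindex_bij_witness[where i = "\<lambda>i. i + m" and j = "\<lambda>i. i - m"], goal_cases)
    case (5 i)
    define d where "d = i - m"
    then have d: "i = m + d" "d + m \<le> K" using 5 by simp_all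
    have e: "K - (i - m) = (K - i) + m" "K - m - (i - m) = K - i"
      "K - (K - i) = (K - (K + m - i)) + m"
      using d(2) unfolding d(1) by simp_all
    have b: "K choose (K - i) = K choose i" using 5 binomial_symmetric[of i K] by simp
    have b': "K choose (K + m - i) = K choose (i - m)"
    proof -
      have "i - m \<le> K" "K - (i - m) = K + m - i" using 5 by auto
      then show ?thesis using binomial_symmetric[of "i - m" K] by simp
    qed
    have "x\<^sup>2 - 1 = (x + 1) * (x - 1)" by (simp add: power2_eq_square algebra_simps)
    then have "(x\<^sup>2 - 1) ^ m = (x + 1) ^ m * (x - 1) ^ m" by (simp only: power_mult_distrib)
    then show ?case unfolding e(2) unfolding e(1,3) b b' power_add by (simp only: mult_ac)
  qed (use assms in auto)
  finally show ?thesis by (simp only: rodrigues_coeff_product[of K "K - m"])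
qed

section \<open>Legendre functions as Rodrigues coefficients\<close>

lemma Gamma_of_nat_plus_half:
  "Gamma (real n + 1 / 2) = fact (2 * n) / (4 ^ n * fact n) * sqrt pi"
proof (induction n)
  case 0
  then show ?case by (simp add: Gamma_one_half_real)
next
  case (Suc n)
  have "real n + 1 / 2 \<notin> \<int>\<^sub>\<le>\<^sub>0"
    using nonpos_Ints_nonpos[of "real n + 1 / 2"] by auto
  then have "Gamma (real n + 1 / 2 + 1) = (real n + 1 / 2) * Gamma (real n + 1 / 2)"
    by (rule Gamma_plus1)
  moreover have "fact (2 * Suc n) / (4 ^ Suc n * fact (Suc n)) =
      (real n + 1 / 2) * (fact (2 * n) / (4 ^ n * fact n))"
  proof -
    have aux: "(2 * c * (2 * r + 1) * f) / (4 * p * (c * q)) = (r + 1 / 2) * (f / (p * q))"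
      if "c > 0" for c r f p q :: real
      using that by (simp add: divide_simps)
    have "(fact (2 * Suc n) :: real) = 2 * real (Suc n) * (2 * real n + 1) * fact (2 * n)"
      by (simp add: algebra_simps)
    then show ?thesis
      using aux[of "real (Suc n)" "real n" "fact (2 * n)" "4 ^ n" "fact n"]
      by (simp only: power_Suc fact_Suc of_nat_0_less_iff zero_less_Suc)
  qed
  moreover have "real (Suc n) + 1 / 2 = real n + 1 / 2 + 1" by simp
  ultimately show ?case using Suc by (simp only: mult.assoc)
qed

text \<open>
  Rodrigues' formula for Gegenbauer polynomials of half-integer parameter. With Gamma values
  at half-integers written by factorials, the defining sum is termwise the expansion of
  \<open>(- 1 + (t + x)\<^sup>2) ^ k\<close> by powers of the square.
\<close>

lemma gegenbauer_half_integer: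
  assumes "m \<le> k"
  shows "fact (2 * m) / (2 ^ m * fact m) * gegenbauer (k - m) (real m + 1 / 2) x =
      fact (k + m) / (2 ^ k * fact k) * rodrigues_coeff k (k + m) x"
proof -
  define c where "c = (fact (2 * m) / (2 ^ m * fact m) * (1 / Gamma (real m + 1 / 2)) :: real)"
  have c: "c = 2 ^ m / sqrt pi"
  proof -
    have "(4 :: real) ^ m = 2 ^ m * 2 ^ m" by (simp flip: power_mult_distrib)
    then show ?thesis unfolding c_def Gamma_of_nat_plus_half by (simp add: field_simps)
  qed
  have "fact (2 * m) / (2 ^ m * fact m) * gegenbauer (k - m) (real m + 1 / 2) x =
     (\<Sum>j\<le>(k - m) div 2. c * ((-1) ^ j * Gamma (real (k - m) - real j + (real m + 1 / 2)) /
        (fact j * fact (k - m - 2 * j)) * (2 * x) ^ (k - m - 2 * j)))"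
    unfolding gegenbauer_def c_def by (simp add: sum_distrib_left atLeast0AtMost mult_ac)
  also have "\<dots> = (\<Sum>j\<le>(k - m) div 2. fact (k + m) / (2 ^ k * fact k) *
      (real (k choose j) * (-1) ^ j * real ((2 * (k - j)) choose (k + m)) * x ^ (2 * (k - j) - (k + m))))"
  proof (rule sum.cong[OF refl])
    fix j assume "j \<in> {..(k - m) div 2}"
    then have j: "2 * j \<le> k - m" "j \<le> k" "k + m \<le> 2 * (k - j)" using assms by auto
    then obtain d where d: "k = m + 2 * j + d"
      using assms by (metis le_Suc_ex add.assoc le_add_diff_inverse)
    have e: "real (k - m) - real j + (real m + 1 / 2) = real (k - j) + 1 / 2"
      using j assms by (simp add: of_nat_diff)
    have e': "2 * (k - j) - (k + m) = d" "k - m - 2 * j = d" "k - j = m + j + d"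
      "2 * (m + j + d) - (k + m) = d" "k + m + d = 2 * (m + j + d)"
      using d by auto
    have b: "real ((2 * (k - j)) choose (k + m)) = fact (2 * (m + j + d)) / (fact (k + m) * fact d)"
      unfolding binomial_fact[OF j(3)] unfolding e' ..
    have b': "real (k choose j) = fact k / (fact j * fact (m + j + d))"
      unfolding binomial_fact[OF j(2)] unfolding e' ..
    have four: "(4 :: real) ^ n = 2 ^ n * 2 ^ n" for n by (simp flip: power_mult_distrib)
    have p: "(4 :: real) ^ (m + j + d) = 2 ^ k * 2 ^ d * 2 ^ m"
      unfolding four d power_add mult_2 by (simp only: mult_ac)
    show "c * ((-1) ^ j * Gamma (real (k - m) - real j + (real m + 1 / 2)) /
        (fact j * fact (k - m - 2 * j)) * (2 * x) ^ (k - m - 2 * j)) = fact (k + m) / (2 ^ k * fact k) *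
      (real (k choose j) * (-1) ^ j * real ((2 * (k - j)) choose (k + m)) * x ^ (2 * (k - j) - (k + m)))"
      unfolding e Gamma_of_nat_plus_half b b' unfolding e' c p power_mult_distrib by (simp add: field_simps)
  qed
  also have "\<dots> = (\<Sum>j\<le>k. fact (k + m) / (2 ^ k * fact k) *
      (real (k choose j) * (-1) ^ j * real ((2 * (k - j)) choose (k + m)) * x ^ (2 * (k - j) - (k + m))))"
    by (intro sum.mono_neutral_left) (auto simp: binomial_eq_0)
  finally show ?thesis unfolding rodrigues_coeff_expand sum_distrib_left .
qed

text \<open>
  For order \<open>m > 0\<close>, Legendre functions carry a sign \<open>(-1) ^ m\<close> on the cut \<open>[-1, 1]\<close> and a sign
  \<open>sgn z ^ m\<close> off it. Absorbing it into the square root of \<open>\<bar>1 - z\<^sup>2\<bar>\<close> makes one formula valid for orders of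
  both signs and on both sides of \<open>\<bar>z\<bar> = 1\<close>.
\<close>

definition legendre_weight :: "real \<Rightarrow> real" where
  "legendre_weight z = (if \<bar>z\<bar> < 1 then - sqrt (1 - z\<^sup>2) else sgn z * sqrt (z\<^sup>2 - 1))"

lemma assoc_legendre_abs_eq:
  assumes "m \<le> K"
  shows "assoc_legendre_abs K (int m) z =
      (-1) ^ m * sqrt \<bar>1 - z\<^sup>2\<bar> ^ m * fact (K + m) / (2 ^ K * fact K) * rodrigues_coeff K (K + m) z"
    and "assoc_legendre_abs K (- int m) z =
      sqrt \<bar>1 - z\<^sup>2\<bar> ^ m * fact (K - m) / (2 ^ K * fact K) * rodrigues_coeff K (K + m) z"
proof -
  have P: "(-1) ^ m * fact (2 * m) / (2 ^ m * fact m) * sqrt \<bar>1 - z\<^sup>2\<bar> ^ m * gegenbauer (K - m) (real m + 1 / 2) z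
     = (-1) ^ m * sqrt \<bar>1 - z\<^sup>2\<bar> ^ m * fact (K + m) / (2 ^ K * fact K) * rodrigues_coeff K (K + m) z"
    using arg_cong[OF gegenbauer_half_integer[OF assms, of z], of "\<lambda>y. (-1) ^ m * sqrt \<bar>1 - z\<^sup>2\<bar> ^ m * y"]
    by (simp only: mult_ac times_divide_eq_left times_divide_eq_right)
  show 1: "assoc_legendre_abs K (int m) z =
      (-1) ^ m * sqrt \<bar>1 - z\<^sup>2\<bar> ^ m * fact (K + m) / (2 ^ K * fact K) * rodrigues_coeff K (K + m) z"
    using assms P by (simp add: assoc_legendre_abs_def Let_def)
  have sg: "(-1) ^ m * ((-1) ^ m * y) = y" for y :: real
    by (simp flip: mult.assoc power_mult_distrib)
  have "assoc_legendre_abs K (- int m) z = (-1) ^ m * fact (K - m) / fact (K + m) *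
     ((-1) ^ m * sqrt \<bar>1 - z\<^sup>2\<bar> ^ m * fact (K + m) / (2 ^ K * fact K) * rodrigues_coeff K (K + m) z)"
  proof (cases "m = 0")
    case True
    then show ?thesis using 1 by simp
  next
    case False
    then show ?thesis using assms P by (simp add: assoc_legendre_abs_def Let_def)
  qed
  also have "\<dots> = (-1) ^ m * ((-1) ^ m * (sqrt \<bar>1 - z\<^sup>2\<bar> ^ m * fact (K - m) / (2 ^ K * fact K) * rodrigues_coeff K (K + m) z))"
    by (simp add: field_simps)
  finally show "assoc_legendre_abs K (- int m) z =
      sqrt \<bar>1 - z\<^sup>2\<bar> ^ m * fact (K - m) / (2 ^ K * fact K) * rodrigues_coeff K (K + m) z"
    unfolding sg .
qed

text \<open>
  The order is written as \<open>N - K\<close> so that no case distinction on its sign remains: the prefactor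
  \<open>(K - m)! / (K + m)!\<close> of negative orders is exactly what turns \<open>(K + m)!\<close> into \<open>N!\<close>, and reflection
  supplies the missing power of \<open>z\<^sup>2 - 1\<close>. For \<open>N > 2 K\<close> both sides vanish.
\<close>

lemma assoc_legendre_eq_rodrigues_coeff:
  assumes "z\<^sup>2 \<noteq> 1"
  shows "assoc_legendre K (int N - int K) z =
    fact N / (2 ^ K * fact K) * legendre_weight z powi (int N - int K) * rodrigues_coeff K N z"
proof -
  let ?w = "sqrt \<bar>1 - z\<^sup>2\<bar>"
  have cut: "\<bar>z\<bar> \<le> 1 \<longleftrightarrow> \<bar>z\<bar> < 1"
    using assms power2_eq_1_iff[of z] by (auto simp: abs_if)
  have sq: "\<bar>z\<bar> < 1 \<longleftrightarrow> z\<^sup>2 < 1" by (simp add: abs_square_less_1)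
  have w: "legendre_weight z = (if \<bar>z\<bar> < 1 then - 1 else sgn z) * ?w"
    unfolding legendre_weight_def sq using assms by auto
  have w0: "legendre_weight z \<noteq> 0"
    unfolding w using assms by (auto simp: sgn_if)
  have sg: "(-1) ^ n * ((-1) ^ n * y) = y" for n and y :: real
    by (simp flip: mult.assoc power_mult_distrib)
  have "2 * K < N \<or> (\<exists>m. N = K + m \<and> m \<le> K) \<or> (\<exists>m. K = N + m)"
    by presburger
  then consider "2 * K < N" | m where "N = K + m" "m \<le> K" | m where "K = N + m"
    by blast
  then show ?thesis
  proof cases
    case 1
    then have "K < nat \<bar>int N - int K\<bar>" by simp
    then show ?thesis using 1
      by (simp add: rodrigues_coeff_eq_0 assoc_legendre_def assoc_legendre_abs_def Let_def)
  next
    case 2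
    then have o: "int N - int K = int m" by simp
    have "(if \<bar>z\<bar> \<le> 1 then 1 else sgn z ^ nat \<bar>int m\<bar> * (if 0 < int m then (-1) ^ nat (int m) else 1)) * (-1) ^ m * ?w ^ m
        = legendre_weight z ^ m"
      unfolding w cut power_mult_distrib
      by (cases "m = 0") (simp_all add: power_mult_distrib[symmetric])
    then show ?thesis
      unfolding o assoc_legendre_def assoc_legendre_abs_eq(1)[OF 2(2)]
      by (simp add: 2(1) mult_ac)
  next
    case 3
    then have o: "int N - int K = - int m" "m \<le> K" and N: "N = K - m" by simp_all
    have "z\<^sup>2 - 1 = (if \<bar>z\<bar> < 1 then - 1 else 1) * ?w\<^sup>2"
      unfolding sq using assms by auto
    then have r: "rodrigues_coeff K N z = ((if \<bar>z\<bar> < 1 then - 1 else 1) * ?w\<^sup>2) ^ m * rodrigues_coeff K (K + m) z"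
      unfolding N using rodrigues_coeff_reflect[OF o(2), of z] by (simp only:)
    have "((if \<bar>z\<bar> < 1 then 1 else sgn z) * legendre_weight z) * ?w = (if \<bar>z\<bar> < 1 then - 1 else 1) * ?w\<^sup>2"
      unfolding w by (auto simp: power2_eq_square sgn_if)
    then have "((if \<bar>z\<bar> < 1 then 1 else sgn z) * ?w) ^ m * legendre_weight z ^ m
       = ((if \<bar>z\<bar> < 1 then - 1 else 1) * ?w\<^sup>2) ^ m"
      by (simp only: power_mult_distrib[symmetric] mult_ac)
    then have r': "rodrigues_coeff K N z = (if \<bar>z\<bar> < 1 then 1 else sgn z) ^ m * ?w ^ m * legendre_weight z ^ m * rodrigues_coeff K (K + m) z"
      unfolding r by (simp only: power_mult_distrib)
    have "(if \<bar>z\<bar> \<le> 1 then 1 else sgn z ^ nat \<bar>- int m\<bar> * (if 0 < - int m then (-1) ^ nat (- int m) else 1)) =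
        (if \<bar>z\<bar> < 1 then 1 else sgn z) ^ m"
      unfolding cut by simp
    then show ?thesis
      unfolding o assoc_legendre_def assoc_legendre_abs_eq(2)[OF o(2)] r' using w0
      by (simp add: N power_int_minus field_simps)
  qed
qed

section \<open>The generating function and the core identity\<close>

text \<open>
  The definition of \<open>g\<^sub>n\<close> by a convergent series, turned into an identity of formal power series.
  After multiplication by \<open>(1 - u) ^ K\<close>, both sides have the sum \<open>(1 + u) ^ A\<close> for
  \<open>\<bar>u\<bar> < 1\<close>; this is the case \<open>\<tau> = 0\<close> of the generating function, so the uniqueness of that
  expansion identifies the coefficients.
\<close>

lemma g_coeff_fps:
  "Abs_fps (\<lambda>n. g_coeff n (real K) (real A - real K)) * (1 - fps_X) ^ K = (1 + fps_X) ^ A"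
proof -
  let ?G = "Abs_fps (\<lambda>n. g_coeff n (real K) (real A - real K))"
  have G: "(\<lambda>n. ?G $ n * u ^ n) sums ((1 + u) ^ A / (1 - u) ^ K)" if "\<bar>u\<bar> < 1" for u
    using g_coeff_sums[OF that, of "real K" "real A - real K"] that
    by (simp add: powr_minus powr_realpow divide_inverse)
  have rad: "1 \<le> fps_conv_radius ?G"
    unfolding fps_conv_radius_def
    by (rule conv_radius_geI_ex') (use G in \<open>auto simp: sums_iff one_ereal_def\<close>)
  have radA: "fps_conv_radius ((1 + fps_X :: real fps) ^ A) = \<infinity>"
    and radK: "fps_conv_radius ((1 - fps_X :: real fps) ^ K) = \<infinity>"
    using fps_conv_radius_power[of "1 + fps_X :: real fps" A] fps_conv_radius_add[of "1 :: real fps" fps_X]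
      fps_conv_radius_power[of "1 - fps_X :: real fps" K] fps_conv_radius_diff[of "1 :: real fps" fps_X]
    by simp_all
  have evalA: "eval_fps ((1 + fps_X) ^ A) u = (1 + u) ^ A"
    and evalK: "eval_fps ((1 - fps_X) ^ K) u = (1 - u) ^ K" for u :: real
    using fps_conv_radius_add[of "1 :: real fps" fps_X] fps_conv_radius_diff[of "1 :: real fps" fps_X]
    by (simp_all add: eval_fps_power eval_fps_add eval_fps_diff)
  have 1: "(\<lambda>n. (?G * (1 - fps_X) ^ K) $ n * u ^ n) sums ((1 + u) powr (0 + real A) * (1 - u) powr (- 0))"
    if u: "\<bar>u\<bar> < 1" for u
  proof -
    have r: "norm u < fps_conv_radius ?G"
      using u by (intro less_le_trans[OF _ rad]) (simp add: one_ereal_def)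
    have r': "norm u < fps_conv_radius (?G * (1 - fps_X) ^ K)"
      using r fps_conv_radius_mult[of ?G "(1 - fps_X) ^ K"] by (simp add: radK)
    have "eval_fps (?G * (1 - fps_X) ^ K) u = (1 + u) ^ A / (1 - u) ^ K * (1 - u) ^ K"
      using r radK evalK G[OF u] by (subst eval_fps_mult) (auto simp: eval_fps_def sums_iff)
    moreover have "1 - u \<noteq> 0" using u by auto
    ultimately show ?thesis using sums_eval_fps[OF r'] u by (simp add: powr_realpow)
  qed
  have 2: "(\<lambda>n. ((1 + fps_X) ^ A) $ n * u ^ n) sums ((1 + u) powr (0 + real A) * (1 - u) powr (- 0))"
    if u: "\<bar>u\<bar> < 1" for u :: real
  proof -
    have "1 - u \<noteq> 0" using u by auto
    then show ?thesis
      using sums_eval_fps[of u "(1 + fps_X) ^ A"] u by (simp add: radA evalA powr_realpow)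
  qed
  show ?thesis
    using g_coeff_ex1[of 0 "real A"] 1 2 by (subst fps_nth_inject[symmetric]) blast
qed

text \<open>
  The left-hand sum is a Cauchy product with the rescaled generating function. Its scaling
  \<open>u = - t / (1 + z)\<close> turns \<open>1 - u\<close> and \<open>1 + u\<close> into multiples of \<open>t + z + 1\<close> and \<open>1 + z - t\<close>,
  and the first of these is a factor of \<open>(t + z)\<^sup>2 - 1\<close>.
\<close>

lemma sum_g_coeff_rodrigues_coeff:
  assumes "z \<noteq> - 1"
  shows "(1 + z) ^ A * (\<Sum>n\<le>k. g_coeff n (real K) (real A - real K) * (- 1 / (1 + z)) ^ n
             * rodrigues_coeff K (k - n) z) =
    (1 + z) ^ K * ((fps_const (- 1) * fps_X + fps_const (1 + z)) ^ A * (fps_X + fps_const (z - 1)) ^ K) $ k"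
proof -
  define c where "c = - 1 / (1 + z)"
  \<comment> \<open>\<open>H\<close> is the rescaled generating function.\<close>
  define H where "H = Abs_fps (\<lambda>n. c ^ n * g_coeff n (real K) (real A - real K))"
  have z: "1 + z \<noteq> 0" using assms by linarith
  have "Abs_fps (\<lambda>n. g_coeff n (real K) (real A - real K)) oo (fps_const c * fps_X) = H"
    unfolding H_def fps_compose_linear by simp
  then have H: "H * (1 - fps_const c * fps_X) ^ K = (1 + fps_const c * fps_X) ^ A"
    using arg_cong[OF g_coeff_fps[of K A], of "\<lambda>f. f oo (fps_const c * fps_X)"]
    by (simp add: fps_compose_mult_distrib fps_compose_power[symmetric] fps_compose_sub_distrib fps_compose_add_distrib)
  have minus: "fps_const (1 + z) * (1 - fps_const c * fps_X) = fps_X + fps_const (z + 1)"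
    and plus: "fps_const (1 + z) * (1 + fps_const c * fps_X) = fps_const (- 1) * fps_X + fps_const (1 + z)"
  proof -
    have "fps_const (1 + z) * (fps_const c * fps_X) = fps_const (- 1) * fps_X"
      using z by (simp add: c_def flip: mult.assoc)
    then show "fps_const (1 + z) * (1 - fps_const c * fps_X) = fps_X + fps_const (z + 1)"
      and "fps_const (1 + z) * (1 + fps_const c * fps_X) = fps_const (- 1) * fps_X + fps_const (1 + z)"
      by (simp_all add: right_diff_distrib distrib_left add.commute del: fps_const_add flip: fps_const_neg)
  qed
  have "fps_const (1 + z) ^ A * (H * ((fps_X + fps_const z)\<^sup>2 - 1) ^ K) =
      fps_const (1 + z) ^ A * (H * (1 - fps_const c * fps_X) ^ K) * fps_const (1 + z) ^ K * (fps_X + fps_const (z - 1)) ^ K"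
    unfolding fps_rodrigues_factor minus[symmetric] power_mult_distrib by (simp only: mult_ac)
  also have "\<dots> = fps_const (1 + z) ^ K * ((fps_const (- 1) * fps_X + fps_const (1 + z)) ^ A * (fps_X + fps_const (z - 1)) ^ K)"
    unfolding H plus[symmetric] power_mult_distrib by (simp only: mult_ac)
  finally have "((1 + z) ^ A * (H * ((fps_X + fps_const z)\<^sup>2 - 1) ^ K) $ k) =
      (1 + z) ^ K * ((fps_const (- 1) * fps_X + fps_const (1 + z)) ^ A * (fps_X + fps_const (z - 1)) ^ K) $ k"
    by (metis fps_const_power fps_mult_left_const_nth)
  moreover have "(H * ((fps_X + fps_const z)\<^sup>2 - 1) ^ K) $ k =
      (\<Sum>n\<le>k. g_coeff n (real K) (real A - real K) * c ^ n * rodrigues_coeff K (k - n) z)"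
    unfolding fps_mult_nth H_def rodrigues_coeff_def by (simp add: atLeast0AtMost mult_ac)
  ultimately show ?thesis unfolding c_def by simp
qed

text \<open>
  Both products of binomial coefficients have the same factorials \<open>j!\<close>, \<open>(A - j)!\<close>, \<open>(k - j)!\<close> and
  \<open>(k - A + j)!\<close> in the denominator, the last because \<open>K - (k - j) = k - (A - j)\<close>.
  If \<open>k < A - j\<close>, both sides vanish.
\<close>

lemma binomial_term_exchange:
  fixes z :: real
  assumes KA: "K + A = 2 * k" and j: "j \<le> A" "j \<le> k" and z: "z \<noteq> 0"
  shows "(fact k)\<^sup>2 * (1 + z) ^ k *
      (real (A choose j) * (- 1) ^ j * (1 + z) ^ (A - j) * (real (K choose (k - j)) * (z - 1) ^ (K - (k - j)))) =
    (- 1) ^ (K + k) * fact K * fact A * (1 + z) ^ A * z ^ K *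
      (real (k choose j) * real (k choose (A - j)) * (1 / z + 1) ^ (k - j) * (1 / z - 1) ^ (k - (A - j)))"
proof (cases "A - j \<le> k")
  case False
  then have "K < k - j" using KA j by linarith
  then show ?thesis using False by (simp add: binomial_eq_0)
next
  case True
  define a b c where "a = A - j" and "b = k - j" and "c = k - a"
  have A: "A = a + j" and k: "k = b + j" and k': "k = a + c" and K: "K = b + c"
    using KA j True unfolding a_def b_def c_def by linarith+
  have e: "A - j = a" "k - j = b" "K - b = c" "k - a = c" using A k k' K by linarith+
  have C: "real (A choose j) = fact A / (fact j * fact a)" "real (K choose b) = fact K / (fact b * fact c)"
    "real (k choose j) = fact k / (fact j * fact b)" "real (k choose a) = fact k / (fact a * fact c)"
    using binomial_fact[OF j(1), where 'a = real] binomial_fact[of b K, where 'a = real]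
      binomial_fact[OF j(2), where 'a = real] binomial_fact[of a k, where 'a = real]
    unfolding e using K k' by auto
  have z1: "z ^ K * ((1 / z + 1) ^ b * (1 / z - 1) ^ c) = (1 + z) ^ b * (1 - z) ^ c"
  proof -
    have "z * (1 / z + 1) = 1 + z" "z * (1 / z - 1) = 1 - z" using z by (simp_all add: field_simps)
    moreover have "z ^ K * ((1 / z + 1) ^ b * (1 / z - 1) ^ c) = (z * (1 / z + 1)) ^ b * (z * (1 / z - 1)) ^ c"
      unfolding K power_mult_distrib power_add by (simp only: mult_ac)
    ultimately show ?thesis by (simp only:)
  qed
  have sgn: "(- 1 :: real) ^ (K + k) * (1 - z) ^ c = (- 1) ^ j * (z - 1) ^ c"
  proof -
    have "K + k = 2 * b + c + j" using K k by simp
    then have "(- 1 :: real) ^ (K + k) = (- 1) ^ j * (- 1) ^ c" by (simp add: power_add)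
    moreover have "(- 1) ^ c * (1 - z) ^ c = (z - 1) ^ c" by (simp flip: power_mult_distrib)
    ultimately show ?thesis by (simp only: mult.assoc)
  qed
  have pw: "(1 + z) ^ k * (1 + z) ^ a = (1 + z) ^ A * (1 + z) ^ b"
    unfolding power_add[symmetric] using A k by (simp add: ac_simps)
  have "(fact k)\<^sup>2 * (1 + z) ^ k *
      (real (A choose j) * (- 1) ^ j * (1 + z) ^ a * (real (K choose b) * (z - 1) ^ c)) =
      (fact k)\<^sup>2 * real (A choose j) * real (K choose b) * ((1 + z) ^ k * (1 + z) ^ a) * ((- 1) ^ j * (z - 1) ^ c)"
    by (simp only: mult_ac)
  also have "\<dots> = fact K * fact A * real (k choose j) * real (k choose a) * ((1 + z) ^ A * (1 + z) ^ b) * ((- 1 :: real) ^ (K + k) * (1 - z) ^ c)"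
    unfolding pw sgn C by (simp add: power2_eq_square mult_ac)
  also have "\<dots> = (- 1) ^ (K + k) * fact K * fact A * (1 + z) ^ A * (real (k choose j) * real (k choose a) * ((1 + z) ^ b * (1 - z) ^ c))"
    by (simp only: mult_ac)
  also have "\<dots> = (- 1) ^ (K + k) * fact K * fact A * (1 + z) ^ A * z ^ K *
      (real (k choose j) * real (k choose a) * (1 / z + 1) ^ b * (1 / z - 1) ^ c)"
    unfolding z1[symmetric] by (simp only: mult_ac)
  finally show ?thesis unfolding e .
qed

lemma fps_coeff_eq_rodrigues_coeff_inverse:
  assumes KA: "K + A = 2 * k" and z: "z \<noteq> 0"
  shows "(fact k)\<^sup>2 * (1 + z) ^ k *
      ((fps_const (- 1) * fps_X + fps_const (1 + z)) ^ A * (fps_X + fps_const (z - 1)) ^ K) $ k =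
    (- 1) ^ (K + k) * fact K * fact A * (1 + z) ^ A * z ^ K * rodrigues_coeff k A (1 / z)"
proof -
  let ?f = "\<lambda>j. real (A choose j) * (- 1) ^ j * (1 + z) ^ (A - j) * (real (K choose (k - j)) * (z - 1) ^ (K - (k - j)))"
  let ?g = "\<lambda>j. real (k choose j) * real (k choose (A - j)) * (1 / z + 1) ^ (k - j) * (1 / z - 1) ^ (k - (A - j))"
  have "((fps_const (- 1) * fps_X + fps_const (1 + z)) ^ A * (fps_X + fps_const (z - 1)) ^ K) $ k = sum ?f {..k}"
    unfolding fps_mult_nth fps_linear_power_nth fps_linear_power_nth1 by (simp only: atLeast0AtMost)
  also have "\<dots> = sum ?f {..min A k}"
    by (intro sum.mono_neutral_right) (auto simp: binomial_eq_0)
  finally have f: "((fps_const (- 1) * fps_X + fps_const (1 + z)) ^ A * (fps_X + fps_const (z - 1)) ^ K) $ k = sum ?f {..min A k}" .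
  have g: "rodrigues_coeff k A (1 / z) = sum ?g {..min A k}"
    unfolding rodrigues_coeff_product by (intro sum.mono_neutral_right) (auto simp: binomial_eq_0)
  show ?thesis
    unfolding f g sum_distrib_left
    by (intro sum.cong[OF refl] binomial_term_exchange[OF KA _ _ z]) simp_all
qed

text \<open>
  The core identity, free of square roots and Legendre functions. It holds for every
  \<open>z\<close> where it makes sense, and so covers the arguments \<open>x\<close> and \<open>1 / x\<close> at once.
\<close>

lemma sum_g_coeff_eq_rodrigues_coeff_inverse:
  assumes KA: "K + A = 2 * k" and z: "z \<noteq> 0" "z \<noteq> - 1"
  shows "(\<Sum>n\<le>k. g_coeff n (real K) (real A - real K) * (- 1 / (1 + z)) ^ n * rodrigues_coeff K (k - n) z) =
    (- 1) ^ (K + k) * (1 + z) powi (int K - int k) * fact K * fact A / (fact k)\<^sup>2 * z ^ K * rodrigues_coeff k A (1 / z)"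
  (is "?T = ?R")
proof -
  let ?W = "((fps_const (- 1) * fps_X + fps_const (1 + z)) ^ A * (fps_X + fps_const (z - 1)) ^ K) $ k"
  have z1: "1 + z \<noteq> 0" using z by linarith
  have eliminate: "t = s * (qK / qk) * fK * fA / F * zK * e"
    if "qA * t = qK * w" "F * qk * w = s * fK * fA * qA * zK * e" "qA \<noteq> 0" "qk \<noteq> 0" "F \<noteq> 0"
    for t w s qA qK qk fA fK F zK e :: real
  proof -
    have "qA * (F * qk * t) = qK * (F * qk * w)" using that(1) by (simp add: algebra_simps)
    also have "\<dots> = qA * (s * qK * fK * fA * zK * e)" unfolding that(2) by (simp only: mult_ac)
    finally have "F * qk * t = s * qK * fK * fA * zK * e" using that(3) by simp
    then show ?thesis using that(4,5) by (simp add: field_simps)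
  qed
  have "(1 + z) powi (int K - int k) = (1 + z) ^ K / (1 + z) ^ k"
    using z1 by (simp add: power_int_diff)
  then show ?thesis
    using eliminate[OF sum_g_coeff_rodrigues_coeff[OF z(2), of A K k]
        fps_coeff_eq_rodrigues_coeff_inverse[OF KA z(1)]] z1
    by simp
qed

section \<open>Expansions of Legendre functions\<close>

text \<open>
  The hypothesis on \<open>\<sigma>\<close> says that the \<open>n\<close>-dependent elementary factors of the Legendre sum are
  the powers of \<open>- 1 / (1 + z)\<close> in the core identity. It holds with \<open>\<sigma> = 1\<close> for \<open>z = x\<close> and with
  \<open>\<sigma> = - 1\<close> for \<open>z = 1 / x\<close>: this is the origin of the alternating sign in one relation of each pair.
\<close>

lemma sum_g_coeff_assoc_legendre:
  assumes KA: "K + A = 2 * k" and x: "- 1 < x" "x < 1"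
    and z: "z \<noteq> 0" "z\<^sup>2 \<noteq> 1"
    and ratio: "\<sigma> * sqrt (1 - x) / (sqrt (1 + x) * legendre_weight z) = - 1 / (1 + z)"
  shows "(\<Sum>n = 0..k. \<sigma> ^ n * g_coeff n (real K) (real A - real K) / fact (k - n) *
      ((1 - x) powr (real n / 2) * assoc_legendre K (int k - int n - int K) z
        / (1 + x) powr (real n / 2 + (real K - real k)))) =
    (- 1) ^ (K + k) * (1 + z) powi (int K - int k) * fact A * z ^ K * rodrigues_coeff k A (1 / z)
      / (2 ^ K * (fact k)\<^sup>2 * (1 + x) powi (int K - int k) * legendre_weight z powi (int K - int k))"
proof -
  let ?w = "legendre_weight z"
  define D where "D = 1 / (2 ^ K * fact K * (1 + x) powi (int K - int k) * ?w powi (int K - int k))"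
  have z1: "z \<noteq> - 1" using z(2) by auto
  have w0: "?w \<noteq> 0"
    using ratio z1 by (auto simp: add_eq_0_iff)
  have half: "y powr (real n / 2) = sqrt y ^ n" if "0 < y" for y n
    using that by (simp add: powr_half_sqrt[symmetric] powr_realpow[symmetric] powr_powr)
  have "\<sigma> ^ n * g_coeff n (real K) (real A - real K) / fact (k - n) *
      ((1 - x) powr (real n / 2) * assoc_legendre K (int k - int n - int K) z
        / (1 + x) powr (real n / 2 + (real K - real k))) =
      D * (g_coeff n (real K) (real A - real K) * (- 1 / (1 + z)) ^ n * rodrigues_coeff K (k - n) z)"
    if n: "n \<le> k" for n
  proof -
    have L: "assoc_legendre K (int k - int n - int K) z =
      fact (k - n) / (2 ^ K * fact K) * ?w powi (int (k - n) - int K) * rodrigues_coeff K (k - n) z"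
      using assoc_legendre_eq_rodrigues_coeff[OF z(2), of K "k - n"] n by (simp add: of_nat_diff)
    have "int (k - n) - int K = - (int K - int k) - int n" using n by simp
    moreover have "?w powi (- d - int n) = 1 / (?w powi d * ?w ^ n)" for d
      using w0 by (simp add: power_int_diff power_int_minus divide_inverse)
    ultimately have W: "?w powi (int (k - n) - int K) = 1 / (?w powi (int K - int k) * ?w ^ n)"
      by (simp only:)
    have "(1 + x) powr (real K - real k) = (1 + x) powi (int K - int k)"
      using x powr_real_of_int'[of "1 + x" "int K - int k"] by simp
    then have Q: "(1 + x) powr (real n / 2 + (real K - real k)) = sqrt (1 + x) ^ n * (1 + x) powi (int K - int k)"
      using x by (simp add: powr_add half)
    have R: "(- 1 / (1 + z)) ^ n = \<sigma> ^ n * sqrt (1 - x) ^ n / (sqrt (1 + x) ^ n * ?w ^ n)"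
      unfolding ratio[symmetric] by (simp add: power_divide power_mult_distrib)
    have H: "(1 - x) powr (real n / 2) = sqrt (1 - x) ^ n" using half[of "1 - x"] x by simp
    show ?thesis
      unfolding L W Q H R D_def by (simp add: mult_ac)
  qed
  then have "(\<Sum>n = 0..k. \<sigma> ^ n * g_coeff n (real K) (real A - real K) / fact (k - n) *
      ((1 - x) powr (real n / 2) * assoc_legendre K (int k - int n - int K) z
        / (1 + x) powr (real n / 2 + (real K - real k)))) =
      D * (\<Sum>n\<le>k. g_coeff n (real K) (real A - real K) * (- 1 / (1 + z)) ^ n * rodrigues_coeff K (k - n) z)"
    unfolding sum_distrib_left atLeast0AtMost by (intro sum.cong) simp_all
  then show ?thesis
    unfolding sum_g_coeff_eq_rodrigues_coeff_inverse[OF KA z(1) z1] D_def by (simp add: mult_ac)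
qed

text \<open>
  In terms of \<open>K = k + s\<close> the two pairs of relations are the cases \<open>s = m\<close> and
  \<open>s = - m\<close> of one pair; hence the integer powers throughout.
\<close>

lemma assoc_legendre_expansions:
  assumes KA: "K + A = 2 * k" and x: "- 1 < x" "x < 1" "x \<noteq> 0"
  shows "assoc_legendre k (int k - int K) x / (2 powi (int K - int k) * fact k * x ^ K) =
      (\<Sum>n = 0..k. (- 1) ^ n * g_coeff n (real K) (real A - real K) / fact (k - n) *
        ((1 - x) powr (real n / 2) * assoc_legendre K (int k - int n - int K) (1 / x)
          / (1 + x) powr (real n / 2 + (real K - real k))))"
    and "assoc_legendre k (int k - int K) (1 / x) / (2 powi (int K - int k) * fact k * x powi (- int k)) =
      (\<Sum>n = 0..k. g_coeff n (real K) (real A - real K) / fact (k - n) *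
        ((1 - x) powr (real n / 2) * assoc_legendre K (int k - int n - int K) x
          / (1 + x) powr (real n / 2 + (real K - real k))))"
proof -
  define p q where "p = sqrt (1 - x)" and "q = sqrt (1 + x)"
  define s where "s = int K - int k"
  have pq: "0 < p" "0 < q" using x by (simp_all add: p_def q_def)
  have q2: "1 + x = q\<^sup>2" using x by (simp add: q_def)
  have x1: "\<bar>x\<bar> < 1" using x by auto
  have x2: "x\<^sup>2 < 1" using x1 by (simp add: abs_square_less_1)
  have s': "int k - int K = int A - int k" "int A - int k = - s" using KA unfolding s_def by simp_all
  have "1 - x\<^sup>2 = (1 - x) * (1 + x)" by (simp add: power2_eq_square algebra_simps)
  then have sqrt_eq: "sqrt (1 - x\<^sup>2) = p * q" by (simp add: p_def q_def real_sqrt_mult)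
  have wx: "legendre_weight x = - (p * q)"
    unfolding legendre_weight_def sqrt_eq using x1 by simp
  have wy: "legendre_weight (1 / x) = p * q / x"
  proof -
    have "\<not> \<bar>1 / x\<bar> < 1" using x1 x(3) by (simp add: field_simps)
    moreover have "(1 / x)\<^sup>2 - 1 = (1 - x\<^sup>2) / x\<^sup>2" using x(3) by (simp add: field_simps)
    ultimately have "legendre_weight (1 / x) = sgn (1 / x) * (p * q / \<bar>x\<bar>)"
      unfolding legendre_weight_def by (simp add: real_sqrt_divide sqrt_eq)
    then show ?thesis using x(3) by (cases "0 < x") (simp_all add: sgn_if)
  qed
  have y: "1 / x \<noteq> 0" "(1 / x)\<^sup>2 \<noteq> 1" "x\<^sup>2 \<noteq> 1"
    using x(3) x2 by (simp_all add: power_divide)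
  have two: "(2 :: real) ^ K = 2 ^ k * 2 powi s"
    unfolding s_def by (simp add: power_int_diff)
  have xK: "x ^ K = x ^ k * x powi s"
    unfolding s_def using x(3) by (simp add: power_int_diff)
  have sgn_s: "(- 1) ^ (K + k) = (- 1 :: real) powi s"
  proof -
    have "(- 1 :: real) powi s = (- 1) ^ K / (- 1) ^ k" unfolding s_def by (simp add: power_int_diff)
    then show ?thesis by (simp add: power_add divide_inverse flip: power_inverse)
  qed
  have sgn_inv: "inverse ((- 1 :: real) powi s) = (- 1) powi s"
    by (rule inverse_unique) (simp flip: power_int_mult_distrib)
  have neg: "(- (p * q)) powi t = (- 1) powi t * (p powi t * q powi t)" for t
    using power_int_mult_distrib[of "- 1" "p * q" t] by (simp add: power_int_mult_distrib)
  have nz: "p powi s \<noteq> 0" "q powi s \<noteq> 0" "x powi s \<noteq> 0" "(2 :: real) powi s \<noteq> 0" using pq x(3) by simp_all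

  show "assoc_legendre k (int k - int K) x / (2 powi (int K - int k) * fact k * x ^ K) =
      (\<Sum>n = 0..k. (- 1) ^ n * g_coeff n (real K) (real A - real K) / fact (k - n) *
        ((1 - x) powr (real n / 2) * assoc_legendre K (int k - int n - int K) (1 / x)
          / (1 + x) powr (real n / 2 + (real K - real k))))"
  proof -
    have r: "(- 1) * sqrt (1 - x) / (sqrt (1 + x) * legendre_weight (1 / x)) = - 1 / (1 + 1 / x)"
    proof -
      have "- 1 * p / (q * (p * q / x)) = - x / q\<^sup>2" using pq x(3) by (simp add: field_simps power2_eq_square)
      also have "\<dots> = - 1 / (1 + 1 / x)" using x unfolding q2[symmetric] by (simp add: field_simps)
      finally show ?thesis unfolding wy p_def q_def .
    qed
    have "1 + 1 / x = q\<^sup>2 / x" using x(3) unfolding q2[symmetric] by (simp add: field_simps)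
    then have e: "(1 + 1 / x) powi s = (1 + x) powi s / x powi s"
      unfolding q2 by (simp add: power_int_divide_distrib)
    have L: "assoc_legendre k (int k - int K) x =
        fact A / (2 ^ k * fact k) * ((- 1) powi s / (p powi s * q powi s)) * rodrigues_coeff k A x"
      unfolding s'(1) assoc_legendre_eq_rodrigues_coeff[OF y(3)] unfolding s'(2) wx power_int_minus neg
      by (simp only: inverse_mult_distrib sgn_inv divide_inverse)
    show ?thesis
      unfolding sum_g_coeff_assoc_legendre[OF KA x(1,2) y(1,2) r] L wy sgn_s
      unfolding s_def[symmetric] e two power_int_divide_distrib power_int_mult_distrib
      using nz x by (simp add: power_one_over field_simps power2_eq_square)
  qed

  show "assoc_legendre k (int k - int K) (1 / x) / (2 powi (int K - int k) * fact k * x powi (- int k)) =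
      (\<Sum>n = 0..k. g_coeff n (real K) (real A - real K) / fact (k - n) *
        ((1 - x) powr (real n / 2) * assoc_legendre K (int k - int n - int K) x
          / (1 + x) powr (real n / 2 + (real K - real k))))"
  proof -
    have r: "1 * sqrt (1 - x) / (sqrt (1 + x) * legendre_weight x) = - 1 / (1 + x)"
    proof -
      have "1 * p / (q * - (p * q)) = - 1 / q\<^sup>2" using pq by (simp add: field_simps power2_eq_square)
      then show ?thesis unfolding wx q2 unfolding p_def[symmetric] using pq by simp
    qed
    have L: "assoc_legendre k (int k - int K) (1 / x) =
        fact A / (2 ^ k * fact k) * (x powi s / (p powi s * q powi s)) * rodrigues_coeff k A (1 / x)"
      unfolding s'(1) assoc_legendre_eq_rodrigues_coeff[OF y(2)]
      unfolding s'(2) wy power_int_minus power_int_divide_distrib power_int_mult_distrib by simp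
    have "(\<Sum>n = 0..k. g_coeff n (real K) (real A - real K) / fact (k - n) *
        ((1 - x) powr (real n / 2) * assoc_legendre K (int k - int n - int K) x
          / (1 + x) powr (real n / 2 + (real K - real k)))) =
        (- 1) powi s * (1 + x) powi s * fact A * x ^ K * rodrigues_coeff k A (1 / x)
      / (2 ^ K * (fact k)\<^sup>2 * (1 + x) powi s * ((- 1) powi s * (p powi s * q powi s)))"
      using sum_g_coeff_assoc_legendre[OF KA x(1,2) x(3) y(3) r]
      unfolding sgn_s s_def[symmetric] wx neg by simp
    also have "\<dots> = fact A * x ^ K * rodrigues_coeff k A (1 / x) / (2 ^ K * (fact k)\<^sup>2 * (p powi s * q powi s))"
      using x by simp
    finally show ?thesis
      unfolding L s_def[symmetric] two xK
      using nz x by (simp add: power_int_minus field_simps power2_eq_square)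
  qed
qed

theorem corollary11:
  fixes k m :: nat and x :: real
  assumes "m \<le> k" and "- 1 < x" and "x < 1" and "x \<noteq> 0"
  shows
    "(assoc_legendre k (- int m) x / (2 ^ m * fact k * x ^ (k + m)) =
       (\<Sum>n = 0..k. (-1) ^ n * g_coeff n (real k + real m) (- 2 * real m) / fact (k - n) *
          ((1 - x) powr (real n / 2) * assoc_legendre (k + m) (- int n - int m) (1 / x)
             / (1 + x) powr (real n / 2 + real m)))) \<and>
     (assoc_legendre k (- int m) (1 / x) / (2 ^ m * fact k * x powi (- int k)) =
       (\<Sum>n = 0..k. g_coeff n (real k + real m) (- 2 * real m) / fact (k - n) *
          ((1 - x) powr (real n / 2) * assoc_legendre (k + m) (- int n - int m) x
             / (1 + x) powr (real n / 2 + real m)))) \<and>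
     (assoc_legendre k (int m) x / (2 powi (- int m) * fact k * x ^ (k - m)) =
       (\<Sum>n = nat (max 0 (2 * int m - int k))..k.
          (-1) ^ n * g_coeff n (real k - real m) (2 * real m) / fact (k - n) *
          ((1 - x) powr (real n / 2) * assoc_legendre (k - m) (int m - int n) (1 / x)
             / (1 + x) powr (real n / 2 - real m)))) \<and>
     (assoc_legendre k (int m) (1 / x) / (2 powi (- int m) * fact k * x powi (- int k)) =
       (\<Sum>n = nat (max 0 (2 * int m - int k))..k.
          g_coeff n (real k - real m) (2 * real m) / fact (k - n) *
          ((1 - x) powr (real n / 2) * assoc_legendre (k - m) (int m - int n) x
             / (1 + x) powr (real n / 2 - real m))))"
proof (intro conjI)
  have KA: "(k + m) + (k - m) = 2 * k" "(k - m) + (k + m) = 2 * k" using assms(1) by simp_all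
  have plus: "real (k + m) = real k + real m" "real (k - m) - (real k + real m) = - 2 * real m"
    "int (k + m) - int k = int m" "int k - int (k + m) = - int m" "real k + real m - real k = real m"
    "\<And>n. int k - int n - int (k + m) = - int n - int m"
    using assms(1) by simp_all
  have minus: "real (k - m) = real k - real m" "real (k + m) - (real k - real m) = 2 * real m"
    "int (k - m) - int k = - int m" "int k - int (k - m) = int m" "real k - real m - real k = - real m"
    "\<And>n. int k - int n - int (k - m) = int m - int n"
    using assms(1) by simp_all
  show "assoc_legendre k (- int m) x / (2 ^ m * fact k * x ^ (k + m)) =
       (\<Sum>n = 0..k. (-1) ^ n * g_coeff n (real k + real m) (- 2 * real m) / fact (k - n) *
          ((1 - x) powr (real n / 2) * assoc_legendre (k + m) (- int n - int m) (1 / x)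
             / (1 + x) powr (real n / 2 + real m)))"
    and "assoc_legendre k (- int m) (1 / x) / (2 ^ m * fact k * x powi (- int k)) =
       (\<Sum>n = 0..k. g_coeff n (real k + real m) (- 2 * real m) / fact (k - n) *
          ((1 - x) powr (real n / 2) * assoc_legendre (k + m) (- int n - int m) x
             / (1 + x) powr (real n / 2 + real m)))"
    using assoc_legendre_expansions[OF KA(1) assms(2-4)]
    unfolding plus power_int_of_nat by simp_all
  \<comment> \<open>The general sums start at \<open>0\<close>; below the stated bound the order exceeds the degree.\<close>
  have vanish: "assoc_legendre (k - m) (int m - int n) z = 0"
    if "n < nat (max 0 (2 * int m - int k))" for n z
  proof -
    have "k - m < nat \<bar>int m - int n\<bar>" using that assms(1) by linarith
    then show ?thesis by (simp add: assoc_legendre_def assoc_legendre_abs_def Let_def)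
  qed
  show "assoc_legendre k (int m) x / (2 powi (- int m) * fact k * x ^ (k - m)) =
       (\<Sum>n = nat (max 0 (2 * int m - int k))..k.
          (-1) ^ n * g_coeff n (real k - real m) (2 * real m) / fact (k - n) *
          ((1 - x) powr (real n / 2) * assoc_legendre (k - m) (int m - int n) (1 / x)
             / (1 + x) powr (real n / 2 - real m)))" (is "?l = sum ?f _")
  proof -
    have "?l = sum ?f {0..k}"
      using assoc_legendre_expansions(1)[OF KA(2) assms(2-4)] unfolding minus by simp
    also have "\<dots> = sum ?f {nat (max 0 (2 * int m - int k))..k}"
      by (rule sum.mono_neutral_right) (auto simp: vanish)
    finally show ?thesis .
  qed
  show "assoc_legendre k (int m) (1 / x) / (2 powi (- int m) * fact k * x powi (- int k)) =
       (\<Sum>n = nat (max 0 (2 * int m - int k))..k.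
          g_coeff n (real k - real m) (2 * real m) / fact (k - n) *
          ((1 - x) powr (real n / 2) * assoc_legendre (k - m) (int m - int n) x
             / (1 + x) powr (real n / 2 - real m)))" (is "?l = sum ?f _")
  proof -
    have "?l = sum ?f {0..k}"
      using assoc_legendre_expansions(2)[OF KA(2) assms(2-4)] unfolding minus by simp
    also have "\<dots> = sum ?f {nat (max 0 (2 * int m - int k))..k}"
      by (rule sum.mono_neutral_right) (auto simp: vanish)
    finally show ?thesis .
  qed
qed

end
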